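(* Let $G=(V,E)$ be a graph (directed or undirected) with $n$ nodes, let $L$ be its combinatorial Laplacian matrix, and let $\alpha:\mathbb{R}_+\to(0,1]$ be a continuous function. Let $\mathbf{p}_0$ be a row vector of length $n$ with nonnegative entries and $\sum_{j=1}^n(\mathbf{p}_0)_j=1$. Then the problem $$\mathbf{p}'(t)=-\mathbf{p}(t)\,L^{\alpha(t)},\quad t>0,\qquad \mathbf{p}(0)=\mathbf{p}_0,$$ admits a solution $\mathbf{p}(t)$ on every interval $[0,T]$, $T>0$, and $\|\mathbf{p}(t)\|_1=1$ for all $t\in[0,T]$.
   Context: A graph is $G=(V,E)$ with $V=\{v_1,\dots,v_n\}$ finite and $E\subseteq V\times V$; it is undirected if $(v_l,v_j)\in E$ implies $(v_j,v_l)\in E$, and directed otherwise. The adjacency matrix $A$ has entries $a_{l,j}=1$ if $(v_l,v_j)\in E$ and $0$ otherwise. The combinatorial Laplacian is $L=D-A$ with $D=\operatorname{diag}(A\mathbf{1})$, where $\mathbf 1$ is the all-ones column vector (so for directed graphs this is the out-degree Laplacian). Here $\mathbb{R}_+=[0,\infty)$, $\mathbf p(t)$ is a row-vector valued function, continuous on $[0,T]$ and differentiable for $t>0$, and $\|\mathbf p\|_1=\sum_j|p_j|$. The matrix $L^{\alpha}$, $\alpha\in(0,1]$, is the matrix function $f(L)$ for $f(z)=z^\alpha$ (principal branch, $0^\alpha=0$): if $L=Z\operatorname{diag}(J_1,\dots,J_p)Z^{-1}$ is a Jordan decomposition with blocks $J_k$ of size $m_k$ and eigenvalue $\lambda_k$,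 then $f(L)=Z\operatorname{diag}(f(J_1),\dots,f(J_p))Z^{-1}$, where $f(J_k)$ is the upper triangular Toeplitz matrix whose $j$-th superdiagonal is constantly $f^{(j)}(\lambda_k)/j!$, $j=0,\dots,m_k-1$. It is well defined because $z\mapsto z^\alpha$ is defined on the spectrum of $L$, i.e. all the derivatives $f^{(j)}(\lambda_k)$ needed exist (in particular the Jordan blocks of $L$ at the eigenvalue $0$ have size $1$). *)

theory Defs
  imports
    "HOL-Analysis.Analysis"
    "Jordan_Normal_Form.Jordan_Normal_Form"
    "Graph_Theory.Pair_Digraph"
begin

(* $ and the dot product denote the operations on the vectors and matrices of
   Jordan_Normal_Form, not those of HOL-Analysis. *)
unbundle no vec_syntax
no_notation inner (infix "\<bullet>" 70)

section \<open>Graphs and Laplacians\<close>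

text \<open>
  A graph is a \<open>pair_fin_digraph\<close>: a finite vertex set \<open>pverts G\<close> with an arbitrary arc set
  \<open>parcs G\<close> of ordered pairs of vertices, self-loops allowed; undirected graphs are those with
  symmetric \<open>parcs G\<close>.  The vertices are enumerated by a bijection \<open>v\<close> from \<open>{..<n}\<close> to
  \<open>pverts G\<close>.
\<close>

definition adjacency_mat :: "nat \<Rightarrow> (nat \<Rightarrow> 'a) \<Rightarrow> 'a pair_pre_digraph \<Rightarrow> real mat" where
  "adjacency_mat n v G = mat n n (\<lambda>(i, j). if (v i, v j) \<in> parcs G then 1 else 0)"

definition laplacian_mat :: "nat \<Rightarrow> (nat \<Rightarrow> 'a) \<Rightarrow> 'a pair_pre_digraph \<Rightarrow> real mat" where
  "laplacian_mat n v G =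
     (let A = adjacency_mat n v G
      in mat_diag n (\<lambda>i. (A *\<^sub>v vec n (\<lambda>_. 1)) $ i) - A)"

section \<open>Functions of matrices via Jordan decompositions\<close>

definition fun_jordan_block :: "(complex \<Rightarrow> complex) \<Rightarrow> nat \<Rightarrow> complex \<Rightarrow> complex mat" where
  "fun_jordan_block f m a =
     mat m m (\<lambda>(i, j). if i \<le> j then (deriv ^^ (j - i)) f a / fact (j - i) else 0)"

text \<open>
  The derivatives of \<open>f\<close> up to order \<open>m - 1\<close> exist at \<open>a\<close>.  This has to be required
  explicitly because \<open>deriv\<close> is a total function.
\<close>

definition defined_on_block :: "(complex \<Rightarrow> complex) \<Rightarrow> nat \<Rightarrow> complex \<Rightarrow> bool" where
  "defined_on_block f m a \<longleftrightarrow> (\<forall>k. Suc k < m \<longrightarrow> (deriv ^^ k) f field_differentiable (at a))"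

definition is_fun_mat :: "(complex \<Rightarrow> complex) \<Rightarrow> complex mat \<Rightarrow> complex mat \<Rightarrow> bool" where
  "is_fun_mat f A B \<longleftrightarrow>
     (\<exists>n_as Z Z'. 0 \<notin> fst ` set n_as \<and>
        similar_mat_wit A (jordan_matrix n_as) Z Z' \<and>
        (\<forall>(m, a) \<in> set n_as. defined_on_block f m a) \<and>
        B = Z * diag_block_mat (map (\<lambda>(m, a). fun_jordan_block f m a) n_as) * Z')"

text \<open>
  The description operator reflects that the result does not depend on the chosen Jordan
  decomposition.  The value is unspecified if \<open>f\<close> is not defined on the spectrum of \<open>A\<close>.
\<close>

definition fun_mat :: "(complex \<Rightarrow> complex) \<Rightarrow> complex mat \<Rightarrow> complex mat" where
  "fun_mat f A = (THE B. is_fun_mat f A B)"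

text \<open>
  Complex \<open>powr\<close> is the principal branch and satisfies \<open>0 powr a = 0\<close>.
\<close>

definition mat_powr :: "real mat \<Rightarrow> real \<Rightarrow> complex mat" where
  "mat_powr A a = fun_mat (\<lambda>z. z powr complex_of_real a) (map_mat complex_of_real A)"

section \<open>The initial value problem\<close>

definition row_mult_mat :: "'a :: semiring_0 vec \<Rightarrow> 'a mat \<Rightarrow> 'a vec" where
  "row_mult_mat p M = vec (dim_col M) (\<lambda>j. p \<bullet> col M j)"

text \<open>
  \<open>p\<close> is a real row-vector valued solution on \<open>[0,T]\<close> of \<open>p'(t) = - p(t) M(t)\<close>, \<open>p(0) = p0\<close>.
  The equation is stated over the complex numbers, since the entries of \<open>M(t)\<close> are formally
  complex.  At \<open>t = T\<close> the derivative is the left derivative.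
\<close>

definition solves_ivp ::
  "nat \<Rightarrow> (real \<Rightarrow> complex mat) \<Rightarrow> real vec \<Rightarrow> real \<Rightarrow> (real \<Rightarrow> real vec) \<Rightarrow> bool" where
  "solves_ivp n M p0 T p \<longleftrightarrow>
     (\<forall>t \<in> {0..T}. p t \<in> carrier_vec n) \<and>
     (\<forall>j < n. continuous_on {0..T} (\<lambda>t. p t $ j)) \<and>
     p 0 = p0 \<and>
     (\<forall>t \<in> {0<..T}. \<forall>j < n.
        ((\<lambda>s. complex_of_real (p s $ j)) has_vector_derivative
           (- row_mult_mat (map_vec complex_of_real (p t)) (M t)) $ j) (at t within {0..T}))"

definition norm1_vec :: "real vec \<Rightarrow> real" where
  "norm1_vec p = (\<Sum>j < dim_vec p. \<bar>p $ j\<bar>)"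

end

theory Submission
  imports Defs "HOL-Complex_Analysis.Cauchy_Integral_Formula"
    "Jordan_Normal_Form.Jordan_Normal_Form_Existence"
begin

text \<open>
  For large \<open>b\<close> the matrix \<open>S = 1 - L/b\<close> is row stochastic.  Its powers are bounded, so every
  eigenvalue \<open>l\<close> of \<open>L\<close> satisfies \<open>|1 - l/b| \<le> 1\<close> and the Jordan blocks at \<open>0\<close> have size \<open>1\<close>.
  With \<open>c = 2b\<close> even \<open>|1 - l/c| < 1\<close> for \<open>l \<noteq> 0\<close>, and the binomial series of
  \<open>z\<^sup>a = c\<^sup>a (1 - (1 - z/c))\<^sup>a\<close> can be differentiated term by term at all eigenvalues.  Hence every Jordan
  decomposition yields \<open>L\<^sup>a = c\<^sup>a \<Sum>\<^sub>k g\<^sub>k P\<^sup>k\<close>, where \<open>P = 1 - L/c\<close> is row stochastic and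
  \<open>g\<^sub>k = (-1)\<^sup>k (a choose k)\<close>.  Since \<open>g\<^sub>0 = 1\<close>, \<open>g\<^sub>k \<le> 0\<close> for \<open>k \<ge> 1\<close> and \<open>\<Sum>\<^sub>k g\<^sub>k = 0\<close>, the matrix
  \<open>K = c 1 - L\<^sup>a\<close> is real and nonnegative with row sums \<open>c\<close>, and it is continuous in \<open>a\<close>.  The Picard
  series for \<open>u' = u K\<close> consists of nonnegative terms whose entries add up to \<open>(c t)\<^sup>k / k!\<close>, and
  \<open>p(t) = exp (- c t) u(t)\<close> is the required solution.
\<close>

section \<open>Signs, sum and decay of the coefficients of (1 - x)^a\<close>

section \<open>The binomial series of a fractional power\<close>

text \<open>The Taylor coefficients of (1 - x)^a at x = 0.\<close>

definition binom_coeff_minus :: "real \<Rightarrow> nat \<Rightarrow> real" where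
  "binom_coeff_minus a k = (- 1) ^ k * (a gchoose k)"

lemma binom_coeff_minus_0 [simp]: "binom_coeff_minus a 0 = 1"
  by (simp add: binom_coeff_minus_def)

text \<open>For \<open>a \<le> 1\<close> all factors of the product are nonnegative and decrease in
  \<open>a\<close>, so this form shows the sign, the decay and the dependence on \<open>a\<close> at
  once.\<close>

lemma binom_coeff_minus_Suc:
  "binom_coeff_minus a (Suc k) = - (a / Suc k) * (\<Prod>i<k. 1 - a / Suc i)"
proof (induction k)
  case 0
  show ?case by (simp add: binom_coeff_minus_def)
next
  case (Suc k)
  have "(a gchoose Suc (Suc k)) * Suc (Suc k) = (a gchoose Suc k) * (a - Suc k)"
    using gbinomial_mult_1[of a "Suc k"] by (simp add: algebra_simps)
  then have "(a gchoose Suc (Suc k)) = (a gchoose Suc k) * (a - Suc k) / Suc (Suc k)"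
    by (simp add: divide_simps del: of_nat_Suc)
  then have "binom_coeff_minus a (Suc (Suc k)) =
      binom_coeff_minus a (Suc k) * (Suc k - a) / Suc (Suc k)"
    by (simp add: binom_coeff_minus_def algebra_simps)
  also have "\<dots> = - (a / Suc (Suc k)) * ((\<Prod>i<k. 1 - a / Suc i) * ((Suc k - a) / Suc k))"
    unfolding Suc.IH by (simp only: times_divide_eq_left times_divide_eq_right mult_minus_left
        minus_divide_left divide_divide_eq_left mult.assoc mult.commute[of "real (Suc k)"])
  also have "(Suc k - a) / Suc k = 1 - a / Suc k"
    by (simp add: divide_simps)
  finally show ?case by simp
qed

text \<open>Each coefficient is \<open>- a / Suc k\<close> times the preceding partial sum, so
  adding it multiplies that sum by one further factor.\<close>

lemma sum_binom_coeff_minus: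
  "(\<Sum>k<Suc N. binom_coeff_minus a k) = (\<Prod>i<N. 1 - a / Suc i)"
  by (induction N) (simp_all add: binom_coeff_minus_Suc algebra_simps)

lemma prod_one_minus_nonneg:
  fixes a :: real
  assumes "a \<le> 1"
  shows "0 \<le> (\<Prod>i<N. 1 - a / Suc i)"
proof (intro prod_nonneg)
  fix i
  show "0 \<le> 1 - a / Suc i" using assms by (simp add: divide_simps)
qed

lemma binom_coeff_minus_Suc_nonpos:
  assumes "0 \<le> a" "a \<le> 1"
  shows "binom_coeff_minus a (Suc k) \<le> 0"
  unfolding binom_coeff_minus_Suc
  using assms prod_one_minus_nonneg[of a k] by (simp add: mult_nonneg_nonneg)

text \<open>The inequality 1 - x <= exp (- x) bounds the product by the exponential of
  \<open>- (a * harm N)\<close>, and the harmonic series diverges.\<close>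

lemma prod_one_minus_tendsto_0:
  fixes a :: real
  assumes "0 < a" "a \<le> 1"
  shows "(\<lambda>N. \<Prod>i<N. 1 - a / Suc i) \<longlonglongrightarrow> 0"
proof (rule tendsto_sandwich[OF _ _ tendsto_const])
  show "\<forall>\<^sub>F N in sequentially. 0 \<le> (\<Prod>i<N. 1 - a / Suc i)"
    using prod_one_minus_nonneg[OF assms(2)] by simp
  have "(\<Prod>i<N. 1 - a / Suc i) \<le> exp (- (a * harm N))" for N
  proof -
    have "(\<Prod>i<N. 1 - a / Suc i) \<le> (\<Prod>i<N. exp (- (a / Suc i)))"
    proof (rule prod_mono, intro conjI)
      fix i
      show "0 \<le> 1 - a / Suc i" using assms by (simp add: divide_simps)
      show "1 - a / Suc i \<le> exp (- (a / Suc i))"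
        using exp_ge_add_one_self[of "- (a / Suc i)"] by simp
    qed
    also have "\<dots> = exp (- (a * harm N))"
      by (induction N) (simp_all add: harm_def algebra_simps exp_add exp_diff divide_simps
          flip: exp_add)
    finally show ?thesis .
  qed
  then show "\<forall>\<^sub>F N in sequentially. (\<Prod>i<N. 1 - a / Suc i) \<le> exp (- (a * harm N))"
    by simp
  have "filterlim (\<lambda>N. a * harm N) at_top sequentially"
    using assms(1) harm_at_top by (rule filterlim_tendsto_pos_mult_at_top[OF tendsto_const])
  then show "(\<lambda>N. exp (- (a * harm N))) \<longlonglongrightarrow> 0"
    using filterlim_compose[OF exp_at_bot] filterlim_uminus_at_top by blast
qed

lemma binom_coeff_minus_sums_0:
  assumes "0 < a" "a \<le> 1"
  shows "binom_coeff_minus a sums 0"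
  unfolding sums_def
  \<comment> \<open>The closed form covers only partial sums with \<open>Suc N\<close> terms, hence
    the shift.\<close>
  by (rule LIMSEQ_imp_Suc) (use prod_one_minus_tendsto_0[OF assms] in \<open>simp only: sum_binom_coeff_minus\<close>)

text \<open>From index 1 on the coefficients have constant sign, so convergence is already absolute
  convergence.\<close>

lemma summable_abs_binom_coeff_minus:
  assumes "0 < a" "a \<le> 1"
  shows "summable (\<lambda>k. \<bar>binom_coeff_minus a k\<bar>)"
proof -
  have "summable (\<lambda>k. binom_coeff_minus a (Suc k))"
    using binom_coeff_minus_sums_0[OF assms] by (subst summable_Suc_iff) (rule sums_summable)
  then have "summable (\<lambda>k. \<bar>binom_coeff_minus a (Suc k)\<bar>)"
    using binom_coeff_minus_Suc_nonpos[of a] assms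
    by (simp add: abs_of_nonpos summable_minus)
  then show ?thesis using summable_Suc_iff[of "\<lambda>k. \<bar>binom_coeff_minus a k\<bar>"] by blast
qed

text \<open>A majorant that is uniform for orders in \<open>{a0..1}\<close>: the product decreases
  in \<open>a\<close>, the prefactor \<open>a\<close> is at most 1, and dividing by
  \<open>a0\<close> removes the prefactor of the coefficient at \<open>a0\<close>.\<close>

lemma abs_binom_coeff_minus_le:
  assumes "0 < a0" "a0 \<le> a" "a \<le> 1"
  shows "\<bar>binom_coeff_minus a k\<bar> \<le> \<bar>binom_coeff_minus a0 k\<bar> / a0"
proof (cases k)
  case 0
  then show ?thesis using assms by simp
next
  case (Suc m)
  have le: "(\<Prod>i<m. 1 - a / Suc i) \<le> (\<Prod>i<m. 1 - a0 / Suc i)"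
    using assms by (intro prod_mono) (auto simp: divide_simps)
  have "\<bar>binom_coeff_minus a k\<bar> = (a / Suc m) * (\<Prod>i<m. 1 - a / Suc i)"
    using assms prod_one_minus_nonneg[of a m] unfolding Suc binom_coeff_minus_Suc
    by (simp add: abs_mult)
  also have "\<dots> \<le> (1 / Suc m) * (\<Prod>i<m. 1 - a0 / Suc i)"
    using assms prod_one_minus_nonneg[of a m]
    by (intro mult_mono le) (auto simp: divide_simps)
  also have "\<dots> = \<bar>binom_coeff_minus a0 k\<bar> / a0"
    using assms prod_one_minus_nonneg[of a0 m] unfolding Suc binom_coeff_minus_Suc
    by (simp add: abs_mult)
  finally show ?thesis .
qed

lemma continuous_on_binom_coeff_minus [continuous_intros]:
  "continuous_on S f \<Longrightarrow> continuous_on S (\<lambda>x. binom_coeff_minus (f x) k)"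
proof (cases k)
  case (Suc m)
  assume "continuous_on S f"
  then show ?thesis
    unfolding Suc binom_coeff_minus_Suc by (intro continuous_intros) auto
qed simp

text \<open>The M-test applies with the uniform majorant. The orders must stay away from 0: if all
  \<open>x k\<close> are 1, the sum is 0 for positive \<open>a\<close> and 1 for
  \<open>a = 0\<close>.\<close>

lemma continuous_on_binomial_series:
  fixes x :: "nat \<Rightarrow> real"
  assumes "0 < a0" and x: "\<And>k. \<bar>x k\<bar> \<le> 1"
  shows "continuous_on {a0..1} (\<lambda>a. \<Sum>k. binom_coeff_minus a k * x k)"
proof (cases "a0 \<le> 1")
  case True
  show ?thesis
  proof (rule uniform_limit_theorem)
    show "uniform_limit {a0..1} (\<lambda>N a. \<Sum>k<N. binom_coeff_minus a k * x k)
            (\<lambda>a. \<Sum>k. binom_coeff_minus a k * x k) sequentially"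
    proof (rule Weierstrass_m_test)
      show "summable (\<lambda>k. \<bar>binom_coeff_minus a0 k\<bar> / a0)"
        by (intro summable_divide summable_abs_binom_coeff_minus assms True)
      fix k a assume "a \<in> {a0..1}"
      then have "\<bar>binom_coeff_minus a k\<bar> * \<bar>x k\<bar> \<le> \<bar>binom_coeff_minus a0 k\<bar> / a0 * 1"
        using assms by (intro mult_mono abs_binom_coeff_minus_le x) auto
      then show "norm (binom_coeff_minus a k * x k) \<le> \<bar>binom_coeff_minus a0 k\<bar> / a0"
        by (simp add: abs_mult)
    qed
  qed (auto intro!: always_eventually continuous_intros)
qed simp

lemma summable_binomial_series:
  fixes x :: "nat \<Rightarrow> real"
  assumes "0 < a" "a \<le> 1" and "\<And>k. \<bar>x k\<bar> \<le> 1"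
  shows "summable (\<lambda>k. binom_coeff_minus a k * x k)"
proof (rule summable_comparison_test')
  show "summable (\<lambda>k. \<bar>binom_coeff_minus a k\<bar>)"
    by (rule summable_abs_binom_coeff_minus[OF assms(1,2)])
  show "norm (binom_coeff_minus a k * x k) \<le> \<bar>binom_coeff_minus a k\<bar>" for k
    using mult_left_le[OF assms(3)[of k] abs_ge_zero[of "binom_coeff_minus a k"]]
    by (simp add: abs_mult)
qed

text \<open>Only the term of index 0 has a positive coefficient. This is the source of the
  nonnegativity of \<open>c 1 - L^a\<close>.\<close>

lemma binomial_series_le:
  fixes x :: "nat \<Rightarrow> real"
  assumes a: "0 < a" "a \<le> 1" and x: "\<And>k. 0 \<le> x k" "\<And>k. x k \<le> 1"
  shows "(\<Sum>k. binom_coeff_minus a k * x k) \<le> x 0"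
proof -
  have s: "summable (\<lambda>k. binom_coeff_minus a k * x k)"
    using x by (intro summable_binomial_series a) (simp add: abs_le_iff order_trans[of _ 0])
  have "(\<Sum>k. binom_coeff_minus a (Suc k) * x (Suc k)) \<le> (\<Sum>k. 0)"
    using binom_coeff_minus_Suc_nonpos[of a] a x
      summable_Suc_iff[of "\<lambda>k. binom_coeff_minus a k * x k"] s
    by (intro suminf_le mult_nonpos_nonneg) auto
  then show ?thesis using suminf_split_head[OF s] by simp
qed

section \<open>Linearity and multiplicativity of functions applied to Jordan matrices\<close>

section \<open>Functions of Jordan matrices\<close>

lemma fun_jordan_block_dim [simp]:
  "dim_row (fun_jordan_block f m a) = m" "dim_col (fun_jordan_block f m a) = m"
  by (simp_all add: fun_jordan_block_def)

lemma fun_jordan_block_const_1: "fun_jordan_block (\<lambda>_. 1) m a = 1\<^sub>m m"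
  by (rule eq_matI) (auto simp: fun_jordan_block_def)

lemma fun_jordan_block_ident: "fun_jordan_block (\<lambda>z. z) m a = jordan_block m a"
  by (rule eq_matI) (auto simp: fun_jordan_block_def jordan_block_def)

text \<open>The product of two upper triangular Toeplitz matrices convolves their superdiagonals;
  for Taylor coefficients this is the Leibniz rule.\<close>

lemma fun_jordan_block_mult:
  assumes "f analytic_on {a}" "g analytic_on {a}"
  shows "fun_jordan_block (\<lambda>z. f z * g z) m a = fun_jordan_block f m a * fun_jordan_block g m a"
proof (rule eq_matI)
  fix i j assume "i < dim_row (fun_jordan_block f m a * fun_jordan_block g m a)"
    and "j < dim_col (fun_jordan_block f m a * fun_jordan_block g m a)"
  then have ij: "i < m" "j < m" by simp_all
  let ?F = "\<lambda>d. (deriv ^^ d) f a / fact d" and ?G = "\<lambda>d. (deriv ^^ d) g a / fact d"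
  have "(fun_jordan_block f m a * fun_jordan_block g m a) $$ (i, j) =
      (\<Sum>k<m. (if i \<le> k then ?F (k - i) else 0) * (if k \<le> j then ?G (j - k) else 0))"
    using ij by (simp add: scalar_prod_def fun_jordan_block_def atLeast0LessThan)
  also have "\<dots> = (\<Sum>k\<in>{i..j}. ?F (k - i) * ?G (j - k))"
    using ij by (intro sum.mono_neutral_cong_right) auto
  also have "\<dots> = fun_jordan_block (\<lambda>z. f z * g z) m a $$ (i, j)"
  proof (cases "i \<le> j")
    case True
    have "(\<Sum>k\<in>{i..j}. ?F (k - i) * ?G (j - k)) = (\<Sum>d\<in>{0..j - i}. ?F d * ?G (j - i - d))"
      using True by (intro sum.reindex_bij_witness[of _ "\<lambda>d. d + i" "\<lambda>k. k - i"]) auto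
    also have "\<dots> = (\<Sum>d\<in>{0..j - i}. of_nat ((j - i) choose d) *
        (deriv ^^ d) f a * (deriv ^^ (j - i - d)) g a) / fact (j - i)"
      unfolding sum_divide_distrib
      by (intro sum.cong refl) (simp add: binomial_fact)
    also have "\<dots> = (deriv ^^ (j - i)) (\<lambda>z. f z * g z) a / fact (j - i)"
      by (simp only: higher_deriv_mult_at[OF assms])
    finally show ?thesis using ij True by (simp add: fun_jordan_block_def)
  qed (use ij in \<open>simp add: fun_jordan_block_def\<close>)
  finally show "fun_jordan_block (\<lambda>z. f z * g z) m a $$ (i, j) =
      (fun_jordan_block f m a * fun_jordan_block g m a) $$ (i, j)" ..
qed simp_all

lemma fun_jordan_block_power:
  assumes "f analytic_on {a}"
  shows "fun_jordan_block (\<lambda>z. f z ^ k) m a = fun_jordan_block f m a ^\<^sub>m k"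
proof (induction k)
  case (Suc k)
  have "fun_jordan_block (\<lambda>z. f z ^ k * f z) m a = fun_jordan_block f m a ^\<^sub>m Suc k"
    using assms by (simp add: fun_jordan_block_mult analytic_on_power Suc.IH)
  then show ?case by (simp only: power_Suc mult.commute)
qed (simp add: fun_jordan_block_const_1)

text \<open>The middle factor of the product in \<open>is_fun_mat\<close>.\<close>

definition fun_jordan_matrix :: "(complex \<Rightarrow> complex) \<Rightarrow> (nat \<times> complex) list \<Rightarrow> complex mat" where
  "fun_jordan_matrix f n_as = diag_block_mat (map (\<lambda>(m, a). fun_jordan_block f m a) n_as)"

lemma fun_jordan_matrix_Cons:
  "fun_jordan_matrix f ((m, a) # n_as) =
     four_block_mat (fun_jordan_block f m a) (0\<^sub>m m (sum_list (map fst n_as)))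
       (0\<^sub>m (sum_list (map fst n_as)) m) (fun_jordan_matrix f n_as)"
proof -
  have "dim_row \<circ> (\<lambda>(m, a). fun_jordan_block f m a) = fst"
    "dim_col \<circ> (\<lambda>(m, a). fun_jordan_block f m a) = fst"
    by auto
  then show ?thesis
    by (simp add: fun_jordan_matrix_def Let_def dim_diag_block_mat)
qed

lemma fun_jordan_matrix_dim [simp]:
  "dim_row (fun_jordan_matrix f n_as) = sum_list (map fst n_as)"
  "dim_col (fun_jordan_matrix f n_as) = sum_list (map fst n_as)"
  by (induction n_as)
    (auto simp: fun_jordan_matrix_Cons, auto simp: fun_jordan_matrix_def)

text \<open>
  The position of an entry determines the Taylor coefficient it holds, independently of the
  function; this reduces statements about limits and linear combinations to Taylor coefficients.
\<close>

lemma fun_jordan_matrix_entry: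
  assumes "r < sum_list (map fst n_as)" "s < sum_list (map fst n_as)"
  shows "(\<forall>f. fun_jordan_matrix f n_as $$ (r, s) = 0) \<or>
    (\<exists>(m, a) \<in> set n_as. \<exists>d < m. \<forall>f. fun_jordan_matrix f n_as $$ (r, s) = (deriv ^^ d) f a / fact d)"
  using assms
proof (induction n_as arbitrary: r s)
  case (Cons p n_as)
  obtain m a where p: "p = (m, a)" by force
  let ?N = "sum_list (map fst n_as)"
  consider "r < m" "s < m" | "r < m \<and> m \<le> s \<or> m \<le> r \<and> s < m" | "m \<le> r" "m \<le> s"
    by linarith
  then show ?case
  proof cases
    case 1
    then have eq: "fun_jordan_matrix f (p # n_as) $$ (r, s) =
        (if r \<le> s then (deriv ^^ (s - r)) f a / fact (s - r) else 0)" for f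
      by (simp add: p fun_jordan_matrix_Cons fun_jordan_block_def)
    show ?thesis
    proof (cases "r \<le> s")
      case True
      then have "\<forall>f. fun_jordan_matrix f (p # n_as) $$ (r, s) = (deriv ^^ (s - r)) f a / fact (s - r)"
        by (simp only: eq if_True simp_thms)
      moreover have "s - r < m" using 1 by simp
      ultimately have "case p of (m, a) \<Rightarrow> \<exists>d<m. \<forall>f. fun_jordan_matrix f (p # n_as) $$ (r, s) =
          (deriv ^^ d) f a / fact d"
        unfolding p prod.case by blast
      then show ?thesis by (meson list.set_intros(1))
    qed (simp add: eq)
  next
    case 2
    then have "fun_jordan_matrix f (p # n_as) $$ (r, s) = 0" for f
      using Cons.prems by (auto simp: p fun_jordan_matrix_Cons)
    then show ?thesis by blast
  next
    case 3
    then have "fun_jordan_matrix f (p # n_as) $$ (r, s) =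
        fun_jordan_matrix f n_as $$ (r - m, s - m)" for f
      using Cons.prems by (simp add: p fun_jordan_matrix_Cons)
    moreover have "r - m < ?N" "s - m < ?N"
      using Cons.prems 3 by (auto simp: p)
    ultimately show ?thesis
      using Cons.IH[of "r - m" "s - m"] by (simp, blast)
  qed
qed simp

text \<open>The first row of a block of size \<open>m\<close> lists all its Taylor coefficients of
  order below \<open>m\<close>. Bounds on matrix entries thus become bounds on Taylor
  coefficients.\<close>

lemma fun_jordan_matrix_entry_exists:
  assumes "(m, a) \<in> set n_as" "d < m"
  shows "\<exists>r < sum_list (map fst n_as). \<exists>s < sum_list (map fst n_as).
    \<forall>f. fun_jordan_matrix f n_as $$ (r, s) = (deriv ^^ d) f a / fact d"
  using assms
proof (induction n_as)
  case (Cons p n_as)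
  let ?N = "sum_list (map fst n_as)"
  show ?case
  proof (cases "(m, a) = p")
    case True
    then have "\<forall>f. fun_jordan_matrix f (p # n_as) $$ (0, d) = (deriv ^^ d) f a / fact d"
      using Cons.prems by (auto simp: fun_jordan_matrix_Cons fun_jordan_block_def)
    moreover have "0 < sum_list (map fst (p # n_as))" "d < sum_list (map fst (p # n_as))"
      using True[symmetric] Cons.prems by auto
    ultimately show ?thesis by blast
  next
    case False
    obtain m' a' where p: "p = (m', a')" by force
    from Cons False obtain r s where rs: "r < ?N" "s < ?N"
      "\<forall>f. fun_jordan_matrix f n_as $$ (r, s) = (deriv ^^ d) f a / fact d"
      by auto
    then have "\<forall>f. fun_jordan_matrix f (p # n_as) $$ (r + m', s + m') = (deriv ^^ d) f a / fact d"
      by (simp add: p fun_jordan_matrix_Cons)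
    moreover have "r + m' < sum_list (map fst (p # n_as))" "s + m' < sum_list (map fst (p # n_as))"
      using rs p by auto
    ultimately show ?thesis by blast
  qed
qed simp

lemma fun_jordan_matrix_ident: "fun_jordan_matrix (\<lambda>z. z) n_as = jordan_matrix n_as"
  by (simp add: fun_jordan_matrix_def jordan_matrix_def fun_jordan_block_ident)

lemma fun_jordan_matrix_power:
  assumes "\<And>m a. (m, a) \<in> set n_as \<Longrightarrow> f analytic_on {a}"
  shows "fun_jordan_matrix (\<lambda>z. f z ^ k) n_as = fun_jordan_matrix f n_as ^\<^sub>m k"
proof -
  have "fun_jordan_matrix f n_as ^\<^sub>m k =
      diag_block_mat (map (\<lambda>A. A ^\<^sub>m k) (map (\<lambda>(m, a). fun_jordan_block f m a) n_as))"
    unfolding fun_jordan_matrix_def by (rule diag_block_pow_mat) auto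
  also have "map (\<lambda>A. A ^\<^sub>m k) (map (\<lambda>(m, a). fun_jordan_block f m a) n_as) =
      map (\<lambda>(m, a). fun_jordan_block (\<lambda>z. f z ^ k) m a) n_as"
    using assms by (auto simp: fun_jordan_block_power)
  finally show ?thesis by (simp add: fun_jordan_matrix_def)
qed

text \<open>With the outer factors fixed, an entry is a finite linear combination of entries of the
  middle factor, so series and bounds pass through a conjugation.\<close>

lemma index_mult_mat3:
  assumes "A \<in> carrier_mat n n" "B \<in> carrier_mat n n" "C \<in> carrier_mat n n" "i < n" "j < n"
  shows "(A * B * C) $$ (i, j) = (\<Sum>r<n. \<Sum>s<n. A $$ (i, r) * B $$ (r, s) * C $$ (s, j))"
proof -
  have "(A * B * C) $$ (i, j) = (\<Sum>s<n. (\<Sum>r<n. A $$ (i, r) * B $$ (r, s)) * C $$ (s, j))"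
    using assms by (simp add: scalar_prod_def atLeast0LessThan del: assoc_mult_mat)
  also have "\<dots> = (\<Sum>r<n. \<Sum>s<n. A $$ (i, r) * B $$ (r, s) * C $$ (s, j))"
    by (subst sum.swap) (simp add: sum_distrib_right)
  finally show ?thesis .
qed

text \<open>Polynomials in \<open>A\<close> act on the Jordan matrix through the same
  \<open>Z\<close> and \<open>Z'\<close>. Since these do not depend on \<open>k\<close>, series over
  \<open>k\<close> can be summed inside the conjugation.\<close>

lemma jordan_decomposition_power:
  assumes A: "A \<in> carrier_mat n n" and wit: "similar_mat_wit A (jordan_matrix n_as) Z Z'"
  shows "similar_mat_wit ((1\<^sub>m n - w \<cdot>\<^sub>m A) ^\<^sub>m k) (fun_jordan_matrix (\<lambda>z. (1 - w * z) ^ k) n_as) Z Z'"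
proof -
  note D = similar_mat_witD2[OF A wit]
  have N: "sum_list (map fst n_as) = n"
    using carrier_matD(1)[OF D(5)] by simp
  have an: "(\<lambda>z. 1 - w * z) analytic_on {a}" for a
    by (intro analytic_intros)
  have step: "fun_jordan_matrix (\<lambda>z. 1 - w * z) n_as = 1\<^sub>m n - w \<cdot>\<^sub>m jordan_matrix n_as"
    (is "?F = ?R")
  proof (rule eq_matI)
    fix r s assume "r < dim_row ?R" "s < dim_col ?R"
    then have rs: "r < sum_list (map fst n_as)" "s < sum_list (map fst n_as)"
      using N by auto
    \<comment> \<open>The constant function 1 is the power with exponent 0 of the identity
      function.\<close>
    have one: "fun_jordan_matrix (\<lambda>_. 1) n_as = 1\<^sub>m n"
      using fun_jordan_matrix_power[of n_as "\<lambda>z. z" 0] N by simp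
    have lin: "(deriv ^^ d) (\<lambda>z. 1 - w * z) a = (deriv ^^ d) (\<lambda>_. 1) a - w * (deriv ^^ d) (\<lambda>z. z) a"
      for d and a :: complex
    proof -
      have "(deriv ^^ d) (\<lambda>z. 1 - w * z) a = (deriv ^^ d) (\<lambda>_. 1) a - (deriv ^^ d) (\<lambda>z. w * z) a"
        by (rule higher_deriv_diff_at) (intro analytic_intros)+
      also have "(deriv ^^ d) (\<lambda>z. w * z) a = w * (deriv ^^ d) (\<lambda>z. z) a"
        by (rule higher_deriv_cmult') (intro analytic_intros)
      finally show ?thesis .
    qed
    have "?F $$ (r, s) = fun_jordan_matrix (\<lambda>_. 1) n_as $$ (r, s)
        - w * fun_jordan_matrix (\<lambda>z. z) n_as $$ (r, s)"
      using fun_jordan_matrix_entry[OF rs]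
    proof (elim disjE bexE)
      fix p assume "case p of (m, a) \<Rightarrow> \<exists>d<m. \<forall>f. fun_jordan_matrix f n_as $$ (r, s) =
        (deriv ^^ d) f a / fact d"
      then obtain a d where "\<forall>f. fun_jordan_matrix f n_as $$ (r, s) = (deriv ^^ d) f a / fact d"
        by (cases p) blast
      then show ?thesis
        by (simp only: lin diff_divide_distrib times_divide_eq_right)
    qed simp
    then show "?F $$ (r, s) = ?R $$ (r, s)"
      using rs N by (simp add: one fun_jordan_matrix_ident)
  qed (use N in auto)
  have "similar_mat_wit (1\<^sub>m n - w \<cdot>\<^sub>m A) ?F Z Z'"
  proof (rule similar_mat_witI[OF D(1,2)])
    have "Z * ?F * Z' = Z * 1\<^sub>m n * Z' - Z * (w \<cdot>\<^sub>m jordan_matrix n_as) * Z'"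
      unfolding step using D(5-7)
      by (simp add: mult_minus_distrib_mat[of _ n n _ n] minus_mult_distrib_mat[of _ n n _ _ n]
          del: right_mult_one_mat)
    also have "\<dots> = 1\<^sub>m n - w \<cdot>\<^sub>m (Z * jordan_matrix n_as * Z')"
      using D(1,5-7) by (simp add: mult_smult_distrib[of _ n n _ n] mult_smult_assoc_mat[of _ n n _ n])
    finally show "1\<^sub>m n - w \<cdot>\<^sub>m A = Z * ?F * Z'"
      using D(3) by simp
  qed (use D N in auto)
  from similar_mat_wit_pow[OF this, of k] show ?thesis
    by (simp only: fun_jordan_matrix_power[OF an])
qed

section \<open>The series of z^a evaluated on a Jordan matrix\<close>

lemma of_real_gbinomial: "complex_of_real (a gchoose k) = of_real a gchoose k"
  by (simp add: gbinomial_prod_rev)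

text \<open>Newton's series at \<open>z / c - 1\<close>, scaled by c^a.\<close>

lemma powr_binomial_sums:
  fixes a c :: real and z :: complex
  assumes "0 < c" "cmod (1 - z / c) < 1"
  shows "(\<lambda>k. of_real (c powr a * binom_coeff_minus a k) * (1 - z / c) ^ k) sums (z powr of_real a)"
proof -
  have z: "z \<noteq> 0" using assms by auto
  have "(\<lambda>k. (of_real a gchoose k) * (- (1 - z / c)) ^ k) sums (1 + - (1 - z / c)) powr of_real a"
    using assms by (intro gen_binomial_complex) (simp add: norm_minus_commute)
  then have "(\<lambda>k. of_real (c powr a) * ((of_real a gchoose k) * (- (1 - z / c)) ^ k)) sums
      (of_real (c powr a) * (z / c) powr of_real a)"
    by (intro sums_mult) simp
  \<comment> \<open>The principal branch is multiplicative here because \<open>c\<close> is a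
    positive real.\<close>
  also have "of_real (c powr a) * (z / c) powr of_real a = z powr of_real a"
    using z assms Ln_times_of_real[of c "z / c"]
    by (simp add: powr_def Ln_of_real exp_of_real[symmetric] exp_add[symmetric] algebra_simps)
  also have "(\<lambda>k. of_real (c powr a) * ((of_real a gchoose k) * (- (1 - z / c)) ^ k)) =
      (\<lambda>k. of_real (c powr a * binom_coeff_minus a k) * (1 - z / c) ^ k)"
    unfolding power_minus[of "1 - z / c"]
    by (rule ext) (simp add: binom_coeff_minus_def of_real_gbinomial)
  finally show ?thesis .
qed

lemma higher_deriv_sum_at:
  assumes "\<And>k. f k analytic_on {z}"
  shows "(deriv ^^ d) (\<lambda>x. \<Sum>k<(N::nat). f k x) z = (\<Sum>k<N. (deriv ^^ d) (f k) z)"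
  by (induction N) (simp_all add: higher_deriv_add_at assms analytic_on_sum)

text \<open>Inside the disc of convergence, a uniformly convergent series of holomorphic functions
  may be differentiated termwise. The point 0 lies on the boundary of the disc; there only the value
  is considered, and the coefficients sum to 0, which equals \<open>0 powr a\<close>.\<close>

lemma powr_taylor_coeff_sums:
  fixes a c :: real and l :: complex
  assumes a: "0 < a" "a \<le> 1" and c: "0 < c"
    and l: "(l = 0 \<and> d = 0) \<or> cmod (1 - l / c) < 1"
  shows "(\<lambda>k. of_real (c powr a * binom_coeff_minus a k) * (deriv ^^ d) (\<lambda>z. (1 - of_real (1 / c) * z) ^ k) l)
    sums (deriv ^^ d) (\<lambda>z. z powr of_real a) l"
  using l
proof
  assume "l = 0 \<and> d = 0"
  moreover have "(\<lambda>k. complex_of_real (c powr a * binom_coeff_minus a k)) sums of_real (c powr a * 0)"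
    by (intro sums_of_real sums_mult binom_coeff_minus_sums_0 a)
  ultimately show ?thesis by simp
next
  assume l: "cmod (1 - l / c) < 1"
  \<comment> \<open>The open disc of radius \<open>c\<close> about \<open>c\<close>. Absolute
    summability of the coefficients makes the convergence uniform on all of it.\<close>
  define A where "A = {z :: complex. cmod (1 - z / c) < 1}"
  define f where "f k z = of_real (c powr a * binom_coeff_minus a k) * (1 - of_real (1 / c) * z) ^ k"
    for k and z :: complex
  have an: "f k analytic_on X" for k X
    unfolding f_def by (intro analytic_intros)
  have "open A"
    unfolding A_def by (intro open_Collect_less continuous_intros) (use c in auto)
  have f_sums: "(\<lambda>k. f k z) sums (z powr of_real a)" if "z \<in> A" for z
    using powr_binomial_sums[OF c, of z a] that by (simp add: f_def A_def)
  have "uniform_limit A (\<lambda>N z. \<Sum>k<N. f k z) (\<lambda>z. \<Sum>k. f k z) sequentially"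
  proof (rule Weierstrass_m_test)
    show "summable (\<lambda>k. c powr a * \<bar>binom_coeff_minus a k\<bar>)"
      by (intro summable_mult summable_abs_binom_coeff_minus a)
    fix k z assume "z \<in> A"
    then have "cmod (1 - z / c) ^ k \<le> 1"
      by (intro power_le_one) (auto simp: A_def)
    then show "cmod (f k z) \<le> c powr a * \<bar>binom_coeff_minus a k\<bar>"
      by (simp add: f_def norm_mult norm_power abs_mult mult_left_le)
  qed
  then have ul: "uniform_limit A (\<lambda>N z. \<Sum>k<N. f k z) (\<lambda>z. z powr of_real a) sequentially"
    by (rule uniform_limit_cong[THEN iffD1, rotated -1])
      (use f_sums in \<open>auto simp: sums_iff\<close>)
  have "(\<lambda>N. (deriv ^^ d) (\<lambda>z. \<Sum>k<N. f k z) l) \<longlonglongrightarrow> (deriv ^^ d) (\<lambda>z. z powr of_real a) l"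
    by (rule higher_deriv_complex_uniform_limit[OF ul _ _ \<open>open A\<close>])
      (use l in \<open>auto intro!: always_eventually analytic_imp_holomorphic analytic_on_sum an simp: A_def\<close>)
  then have "(\<lambda>N. \<Sum>k<N. (deriv ^^ d) (f k) l) \<longlonglongrightarrow> (deriv ^^ d) (\<lambda>z. z powr of_real a) l"
    by (simp only: higher_deriv_sum_at[OF an])
  moreover have "(deriv ^^ d) (f k) l = of_real (c powr a * binom_coeff_minus a k) *
      (deriv ^^ d) (\<lambda>z. (1 - of_real (1 / c) * z) ^ k) l" for k
    unfolding f_def by (rule higher_deriv_cmult') (intro analytic_intros)
  ultimately show ?thesis by (simp add: sums_def)
qed

text \<open>The terms of the series involve \<open>A\<close> alone and not its Jordan decomposition,
  so every decomposition yields the same matrix.\<close>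

lemma powr_jordan_sums:
  fixes a c :: real
  assumes a: "0 < a" "a \<le> 1" and c: "0 < c"
    and A: "A \<in> carrier_mat n n" and wit: "similar_mat_wit A (jordan_matrix n_as) Z Z'"
    and blocks: "\<And>m (l :: complex). (m, l) \<in> set n_as \<Longrightarrow> (l = 0 \<and> m = 1) \<or> cmod (1 - l / c) < 1"
    and ij: "i < n" "j < n"
  shows "(\<lambda>k. of_real (c powr a * binom_coeff_minus a k) * ((1\<^sub>m n - of_real (1 / c) \<cdot>\<^sub>m A) ^\<^sub>m k) $$ (i, j))
    sums (Z * fun_jordan_matrix (\<lambda>z. z powr of_real a) n_as * Z') $$ (i, j)"
proof -
  note D = similar_mat_witD2[OF A wit]
  have N: "sum_list (map fst n_as) = n"
    using carrier_matD(1)[OF D(5)] by simp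
  have F: "fun_jordan_matrix f n_as \<in> carrier_mat n n" for f
    by (rule carrier_matI) (simp_all add: N)
  let ?w = "complex_of_real (1 / c)" and ?g = "\<lambda>k. complex_of_real (c powr a * binom_coeff_minus a k)"
  let ?F = "\<lambda>k. fun_jordan_matrix (\<lambda>z. (1 - ?w * z) ^ k) n_as"
  have entry: "(\<lambda>k. ?g k * ?F k $$ (r, s)) sums fun_jordan_matrix (\<lambda>z. z powr of_real a) n_as $$ (r, s)"
    if "r < n" "s < n" for r s
    using fun_jordan_matrix_entry[of r n_as s, unfolded N, OF that]
  proof (elim disjE bexE)
    fix p assume p: "p \<in> set n_as" "case p of (m, l) \<Rightarrow> \<exists>d<m. \<forall>f. fun_jordan_matrix f n_as $$ (r, s) =
      (deriv ^^ d) f l / fact d"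
    obtain m l where "p = (m, l)" by fastforce
    with p obtain d where "(m, l) \<in> set n_as" "d < m"
      and eq: "\<forall>f. fun_jordan_matrix f n_as $$ (r, s) = (deriv ^^ d) f l / fact d"
      by blast
    \<comment> \<open>A block of size 1 leaves only \<open>d = 0\<close>.\<close>
    then have "(l = 0 \<and> d = 0) \<or> cmod (1 - l / c) < 1"
      using blocks by fastforce
    from sums_divide[OF powr_taylor_coeff_sums[OF a c this], of "fact d"]
    show ?thesis by (simp only: eq times_divide_eq_right)
  qed simp
  have "?g k * ((1\<^sub>m n - ?w \<cdot>\<^sub>m A) ^\<^sub>m k) $$ (i, j) =
      (\<Sum>r<n. \<Sum>s<n. Z $$ (i, r) * (?g k * ?F k $$ (r, s)) * Z' $$ (s, j))" for k
  proof -
    have "(1\<^sub>m n - ?w \<cdot>\<^sub>m A) ^\<^sub>m k = Z * ?F k * Z'"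
      using jordan_decomposition_power[OF A wit] by (rule similar_mat_witD(3)[OF refl])
    then show ?thesis
      using index_mult_mat3[OF D(6) F D(7) ij] by (simp only: sum_distrib_left mult_ac)
  qed
  then show ?thesis
    unfolding index_mult_mat3[OF D(6) F D(7) ij]
    by (simp only:) (intro sums_sum sums_mult sums_mult2 entry; simp)
qed

section \<open>Eigenvalues and block sizes under bounded powers\<close>

lemma norm_index_mult_mat3_le:
  fixes A B C :: "'a :: real_normed_field mat"
  assumes "A \<in> carrier_mat n n" "B \<in> carrier_mat n n" "C \<in> carrier_mat n n" "i < n" "j < n"
    and B: "\<And>r s. r < n \<Longrightarrow> s < n \<Longrightarrow> norm (B $$ (r, s)) \<le> 1"
  shows "norm ((A * B * C) $$ (i, j)) \<le> (\<Sum>r<n. \<Sum>s<n. norm (A $$ (i, r)) * norm (C $$ (s, j)))"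
  unfolding index_mult_mat3[OF assms(1-5)]
proof (intro order_trans[OF norm_sum] sum_mono)
  fix r s assume "r \<in> {..<n}" "s \<in> {..<n}"
  then have "norm (A $$ (i, r)) * norm (B $$ (r, s)) \<le> norm (A $$ (i, r))"
    using B by (simp add: mult_left_le)
  then show "norm (A $$ (i, r) * B $$ (r, s) * C $$ (s, j)) \<le> norm (A $$ (i, r)) * norm (C $$ (s, j))"
    by (simp add: norm_mult mult_right_mono)
qed

text \<open>Conjugating back, the Taylor coefficients of \<open>(1 - w * z) ^ k\<close> at an
  eigenvalue are bounded in \<open>k\<close>. Order 0 gives powers of \<open>1 - w * l\<close>,
  which restricts the modulus. At \<open>l = 0\<close> the coefficient of order 1 would be
  \<open>- k * w\<close>, which is unbounded, so no block there is large enough to contain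
  it.\<close>

lemma jordan_blocks_of_power_bounded:
  assumes A: "A \<in> carrier_mat n n" and wit: "similar_mat_wit A (jordan_matrix n_as) Z Z'"
    and bounded: "\<And>k i j. i < n \<Longrightarrow> j < n \<Longrightarrow> cmod (((1\<^sub>m n - w \<cdot>\<^sub>m A) ^\<^sub>m k) $$ (i, j)) \<le> 1"
    and w: "w \<noteq> 0" and block: "(m, l) \<in> set n_as" "m \<noteq> 0"
  shows "cmod (1 - w * l) \<le> 1" and "l = 0 \<Longrightarrow> m = 1"
proof -
  note D = similar_mat_witD2[OF A wit]
  have N: "sum_list (map fst n_as) = n"
    using carrier_matD(1)[OF D(5)] by simp
  let ?F = "\<lambda>k. fun_jordan_matrix (\<lambda>z. (1 - w * z) ^ k) n_as"
  have coeff: "\<exists>C. \<forall>k. cmod ((deriv ^^ d) (\<lambda>z. (1 - w * z) ^ k) l) \<le> C" if "d < m" for d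
  proof -
    obtain r s where rs: "r < n" "s < n"
      and eq: "\<forall>f. fun_jordan_matrix f n_as $$ (r, s) = (deriv ^^ d) f l / fact d"
      using fun_jordan_matrix_entry_exists[OF block(1) \<open>d < m\<close>] unfolding N by blast
    have "cmod ((deriv ^^ d) (\<lambda>z. (1 - w * z) ^ k) l / fact d) \<le>
        (\<Sum>p<n. \<Sum>q<n. cmod (Z' $$ (r, p)) * cmod (Z $$ (q, s)))" for k
    proof -
      have "(1\<^sub>m n - w \<cdot>\<^sub>m A) ^\<^sub>m k \<in> carrier_mat n n"
        using A by (intro pow_carrier_mat minus_carrier_mat) auto
      \<comment> \<open>Read backwards, the similarity expresses the Jordan side through the bounded
        powers.\<close>
      moreover from similar_mat_wit_sym[OF jordan_decomposition_power[OF A wit]]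
      have "?F k = Z' * (1\<^sub>m n - w \<cdot>\<^sub>m A) ^\<^sub>m k * Z"
        by (rule similar_mat_witD(3)[OF refl])
      ultimately show ?thesis
        using norm_index_mult_mat3_le[OF D(7) _ D(6) rs] bounded eq by metis
    qed
    then have "cmod ((deriv ^^ d) (\<lambda>z. (1 - w * z) ^ k) l) \<le>
        (\<Sum>p<n. \<Sum>q<n. cmod (Z' $$ (r, p)) * cmod (Z $$ (q, s))) * fact d" for k
      by (simp add: norm_divide pos_divide_le_eq)
    then show ?thesis by blast
  qed
  show "cmod (1 - w * l) \<le> 1"
  proof (rule ccontr)
    assume "\<not> ?thesis"
    moreover obtain C where "\<forall>k. cmod (1 - w * l) ^ k \<le> C"
      using coeff[of 0] block(2) by (auto simp: norm_power)
    ultimately show False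
      using real_arch_pow[of "cmod (1 - w * l)" C] by (simp add: not_le) (meson not_le)
  qed
  show "m = 1" if "l = 0"
  proof (rule ccontr)
    assume "m \<noteq> 1"
    then obtain C where C: "\<And>k. cmod ((deriv ^^ 1) (\<lambda>z. (1 - w * z) ^ k) l) \<le> C"
      using coeff[of 1] block(2) by auto
    have "((\<lambda>z. (1 - w * z) ^ k) has_field_derivative (of_nat k * (- w))) (at 0)" for k
      by (auto intro!: derivative_eq_intros)
    then have "deriv (\<lambda>z. (1 - w * z) ^ k) 0 = of_nat k * (- w)" for k
      by (rule DERIV_imp_deriv)
    then have "real k * cmod w \<le> C" for k
      using C[of k] that by (simp add: norm_mult)
    then show False
      using reals_Archimedean3[of "cmod w"] w by (auto simp: not_le) (meson not_le)
  qed
qed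

text \<open>The closed disc of radius \<open>b\<close> about \<open>b\<close> touches the imaginary
  axis only at 0 and, apart from 0, lies in the open disc of radius \<open>2 * b\<close> about
  \<open>2 * b\<close>. The first part avoids the branch cut, the second gives convergence of the
  series.\<close>

lemma norm_one_minus_half:
  fixes l :: complex and b :: real
  assumes "0 < b" "l \<noteq> 0" "cmod (1 - l / b) \<le> 1"
  shows "0 < Re l" and "cmod (1 - l / (2 * b)) < 1"
proof -
  have "(cmod (1 - l / b))\<^sup>2 \<le> 1"
    using assms(3) by (simp add: power_le_one)
  moreover have "(cmod (1 - l / b))\<^sup>2 = 1 - 2 * Re l / b + (cmod l)\<^sup>2 / b\<^sup>2"
    unfolding cmod_power2 using assms(1)
    by (simp add: power2_eq_square field_simps)
  ultimately have *: "(cmod l)\<^sup>2 / b\<^sup>2 \<le> 2 * Re l / b" by simp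
  have pos: "0 < (cmod l)\<^sup>2 / b\<^sup>2" using assms by simp
  then have "0 < 2 * Re l / b" using * by (rule order_less_le_trans)
  then show "0 < Re l" using assms(1) by (simp add: zero_less_divide_iff)
  have "(cmod (1 - l / (2 * b)))\<^sup>2 = 1 - Re l / b + ((cmod l)\<^sup>2 / b\<^sup>2) / 4"
    unfolding cmod_power2 using assms(1)
    by (simp add: power2_eq_square field_simps)
  also have "\<dots> < 1" using * pos by simp
  finally show "cmod (1 - l / (2 * b)) < 1"
    by (simp add: power_less_one_iff abs_square_less_1)
qed

section \<open>Stochastic matrices and the entries of L^a as real series\<close>

section \<open>Fractional powers of generators\<close>

definition row_stochastic :: "nat \<Rightarrow> real mat \<Rightarrow> bool" where
  "row_stochastic n P \<longleftrightarrow> P \<in> carrier_mat n n \<and>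
     (\<forall>i<n. \<forall>j<n. 0 \<le> P $$ (i, j)) \<and> (\<forall>i<n. (\<Sum>j<n. P $$ (i, j)) = 1)"

lemma row_stochasticD:
  assumes "row_stochastic n P"
  shows "P \<in> carrier_mat n n" "i < n \<Longrightarrow> j < n \<Longrightarrow> 0 \<le> P $$ (i, j)" "i < n \<Longrightarrow> (\<Sum>j<n. P $$ (i, j)) = 1"
  using assms by (simp_all only: row_stochastic_def)

lemma row_stochasticI:
  assumes "\<And>i j. i < n \<Longrightarrow> j < n \<Longrightarrow> 0 \<le> P $$ (i, j)"
    and "\<And>i. i < n \<Longrightarrow> (\<Sum>j<n. P $$ (i, j)) = 1" and "P \<in> carrier_mat n n"
  shows "row_stochastic n P"
  using assms by (simp add: row_stochastic_def)

lemma row_stochastic_one: "row_stochastic n (1\<^sub>m n)"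
  by (simp add: row_stochastic_def)

lemma row_stochastic_mult:
  assumes "row_stochastic n P" "row_stochastic n Q"
  shows "row_stochastic n (P * Q)"
proof -
  have PQ: "P \<in> carrier_mat n n" "Q \<in> carrier_mat n n"
    using assms by (auto simp: row_stochastic_def)
  have entry: "(P * Q) $$ (i, j) = (\<Sum>k<n. P $$ (i, k) * Q $$ (k, j))" if "i < n" "j < n" for i j
    using PQ that by (simp add: scalar_prod_def atLeast0LessThan)
  have "(\<Sum>j<n. (P * Q) $$ (i, j)) = 1" if "i < n" for i
  proof -
    have "(\<Sum>j<n. (P * Q) $$ (i, j)) = (\<Sum>k<n. P $$ (i, k) * (\<Sum>j<n. Q $$ (k, j)))"
      using that by (simp add: entry sum_distrib_left) (rule sum.swap)
    then show ?thesis using assms that by (simp add: row_stochastic_def)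
  qed
  moreover have "0 \<le> (P * Q) $$ (i, j)" if "i < n" "j < n" for i j
    unfolding entry[OF that] using assms that
    by (intro sum_nonneg mult_nonneg_nonneg) (auto simp: row_stochastic_def)
  ultimately show ?thesis using PQ by (simp add: row_stochastic_def)
qed

lemma row_stochastic_pow:
  assumes "row_stochastic n P"
  shows "row_stochastic n (P ^\<^sub>m k)"
proof (induction k)
  case 0
  have "dim_row P = n" using assms by (auto simp: row_stochastic_def)
  then show ?case by (simp add: row_stochastic_one)
qed (simp add: row_stochastic_mult assms)

lemma row_stochastic_le_1:
  assumes "row_stochastic n P" "i < n" "j < n"
  shows "P $$ (i, j) \<le> 1"
proof -
  have "P $$ (i, j) \<le> (\<Sum>j<n. P $$ (i, j))"
    using assms by (intro member_le_sum) (auto simp: row_stochastic_def)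
  then show ?thesis using assms by (simp add: row_stochastic_def)
qed

lemma row_stochastic_pow_bounds:
  assumes "row_stochastic n P" "i < n" "j < n"
  shows "0 \<le> (P ^\<^sub>m k) $$ (i, j)" "(P ^\<^sub>m k) $$ (i, j) \<le> 1" "\<bar>(P ^\<^sub>m k) $$ (i, j)\<bar> \<le> 1"
  using row_stochastic_pow[OF assms(1), of k] row_stochastic_le_1[of n "P ^\<^sub>m k"] assms(2,3)
  by (simp_all add: row_stochastic_def)

text \<open>The new matrix is the average of the identity and the given stochastic matrix.\<close>

lemma row_stochastic_half:
  assumes L: "L \<in> carrier_mat n n" and "row_stochastic n (1\<^sub>m n - (1 / b) \<cdot>\<^sub>m L)"
  shows "row_stochastic n (1\<^sub>m n - (1 / (2 * b)) \<cdot>\<^sub>m L)"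
proof -
  let ?P = "1\<^sub>m n - (1 / (2 * b)) \<cdot>\<^sub>m L" and ?S = "1\<^sub>m n - (1 / b) \<cdot>\<^sub>m L"
  have entry: "?P $$ (i, j) = (1\<^sub>m n $$ (i, j) + ?S $$ (i, j)) / 2" if "i < n" "j < n" for i j
    using that L by (simp add: field_simps)
  have "(\<Sum>j<n. ?P $$ (i, j)) = ((\<Sum>j<n. 1\<^sub>m n $$ (i, j)) + (\<Sum>j<n. ?S $$ (i, j))) / 2"
    if "i < n" for i
    unfolding sum.distrib[symmetric] sum_divide_distrib
    by (rule sum.cong[OF refl]) (use that in \<open>simp only: entry lessThan_iff\<close>)
  moreover have "0 \<le> ?P $$ (i, j)" if "i < n" "j < n" for i j
    unfolding entry[OF that]
    using row_stochasticD(2)[OF row_stochastic_one that] row_stochasticD(2)[OF assms(2) that] by simp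
  moreover have "?P \<in> carrier_mat n n"
    using L by (intro minus_carrier_mat) auto
  ultimately show ?thesis
    by (intro row_stochasticI)
      (simp_all add: row_stochasticD(3)[OF assms(2)] row_stochasticD(3)[OF row_stochastic_one])
qed

text \<open>The entry \<open>(i, j)\<close> of L^a as a real series free of Jordan decompositions;
  \<open>mat_powr_eq\<close> justifies this for \<open>c = 2 * b\<close>.\<close>

definition frac_generator :: "nat \<Rightarrow> real mat \<Rightarrow> real \<Rightarrow> real \<Rightarrow> nat \<Rightarrow> nat \<Rightarrow> real" where
  "frac_generator n L c a i j =
     c powr a * (\<Sum>k. binom_coeff_minus a k * ((1\<^sub>m n - (1 / c) \<cdot>\<^sub>m L) ^\<^sub>m k) $$ (i, j))"

lemma of_real_pow_mat_index:
  fixes L :: "real mat"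
  assumes "L \<in> carrier_mat n n" "i < n" "j < n"
  shows "((1\<^sub>m n - of_real x \<cdot>\<^sub>m map_mat complex_of_real L) ^\<^sub>m k) $$ (i, j) =
    of_real (((1\<^sub>m n - x \<cdot>\<^sub>m L) ^\<^sub>m k) $$ (i, j))"
proof -
  have M: "1\<^sub>m n - x \<cdot>\<^sub>m L \<in> carrier_mat n n"
    using assms by (intro minus_carrier_mat) auto
  have "1\<^sub>m n - of_real x \<cdot>\<^sub>m map_mat complex_of_real L = map_mat complex_of_real (1\<^sub>m n - x \<cdot>\<^sub>m L)"
    by (rule eq_matI) (use assms in auto)
  then show ?thesis
    using of_real_hom.mat_hom_pow[OF M, of k] pow_carrier_mat[OF M, of k] assms
    by (metis carrier_matD(1,2) index_map_mat(1))
qed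

text \<open>The description operator in \<open>fun_mat\<close> needs existence and uniqueness.
  Uniqueness holds because every admissible matrix is the sum of the same series; existence comes
  from the complex Jordan form, once \<open>powr\<close> is known to be defined on the
  spectrum.\<close>

lemma mat_powr_eq:
  assumes L: "L \<in> carrier_mat n n" and b: "0 < b"
    and S: "row_stochastic n (1\<^sub>m n - (1 / b) \<cdot>\<^sub>m L)" and a: "0 < a" "a \<le> 1"
  shows "mat_powr L a = mat n n (\<lambda>(i, j). of_real (frac_generator n L (2 * b) a i j))"
proof -
  let ?A = "map_mat complex_of_real L"
  let ?f = "\<lambda>z :: complex. z powr of_real a"
  have A: "?A \<in> carrier_mat n n" using L by simp
  \<comment> \<open>The powers of \<open>1 - L / b\<close> are stochastic and hence bounded;
    doubling \<open>b\<close> then makes the estimate strict off 0.\<close>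
  have blocks: "(l = 0 \<and> m = 1) \<or> (0 < Re l \<and> cmod (1 - l / (2 * b)) < 1)"
    if wit: "similar_mat_wit ?A (jordan_matrix n_as) Z Z'" and ml: "(m, l) \<in> set n_as"
      and pos: "0 \<notin> fst ` set n_as" for n_as Z Z' m l
  proof -
    have "m \<noteq> 0" using ml pos by force
    have bounded: "cmod (((1\<^sub>m n - of_real (1 / b) \<cdot>\<^sub>m ?A) ^\<^sub>m k) $$ (i, j)) \<le> 1"
      if "i < n" "j < n" for k i j
      unfolding of_real_pow_mat_index[OF L that] norm_of_real
      by (rule row_stochastic_pow_bounds(3)[OF S that])
    have "complex_of_real (1 / b) \<noteq> 0" using b by simp
    note block = jordan_blocks_of_power_bounded[OF A wit bounded this ml \<open>m \<noteq> 0\<close>]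
    show ?thesis
    proof (cases "l = 0")
      case False
      have "cmod (1 - l / b) \<le> 1" using block(1) by simp
      then show ?thesis using norm_one_minus_half[OF b False] by simp
    qed (use block(2) in simp)
  qed
  have unique: "B = mat n n (\<lambda>(i, j). of_real (frac_generator n L (2 * b) a i j))"
    if "is_fun_mat ?f ?A B" for B
  proof -
    obtain n_as Z Z' where pos: "0 \<notin> fst ` set n_as"
      and wit: "similar_mat_wit ?A (jordan_matrix n_as) Z Z'"
      and B: "B = Z * fun_jordan_matrix ?f n_as * Z'"
      using \<open>is_fun_mat ?f ?A B\<close> unfolding is_fun_mat_def fun_jordan_matrix_def by blast
    note D = similar_mat_witD2[OF A wit]
    show ?thesis
    proof (rule eq_matI)
      fix i j assume "i < dim_row (mat n n (\<lambda>(i, j). complex_of_real (frac_generator n L (2 * b) a i j)))"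
        and "j < dim_col (mat n n (\<lambda>(i, j). complex_of_real (frac_generator n L (2 * b) a i j)))"
      then have ij: "i < n" "j < n" by simp_all
      let ?p = "\<lambda>k. ((1\<^sub>m n - (1 / (2 * b)) \<cdot>\<^sub>m L) ^\<^sub>m k) $$ (i, j)"
      have "l = 0 \<and> m = 1 \<or> cmod (1 - l / of_real (2 * b)) < 1" if "(m, l) \<in> set n_as" for m l
        using blocks[OF wit that pos] by auto
      from powr_jordan_sums[OF a _ A wit this ij]
      have "(\<lambda>k. of_real ((2 * b) powr a * binom_coeff_minus a k) * complex_of_real (?p k)) sums B $$ (i, j)"
        using b unfolding of_real_pow_mat_index[OF L ij] B by simp
      moreover have "(\<lambda>k. complex_of_real ((2 * b) powr a * (binom_coeff_minus a k * ?p k))) sums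
          of_real (frac_generator n L (2 * b) a i j)"
        unfolding frac_generator_def
        by (intro sums_of_real sums_mult summable_sums summable_binomial_series a
            row_stochastic_pow_bounds(3)[OF row_stochastic_half[OF L S]] ij)
      ultimately show "B $$ (i, j) = mat n n (\<lambda>(i, j). of_real (frac_generator n L (2 * b) a i j)) $$ (i, j)"
        using ij by (simp add: mult.assoc sums_unique2)
    qed (use D in \<open>auto simp: B\<close>)
  qed
  have "\<exists>B. is_fun_mat ?f ?A B"
  proof -
    obtain n_as where "jordan_nf ?A n_as"
      using char_poly_factorized[OF A] jordan_nf_exists[OF A] by blast
    then obtain Z Z' where pos: "0 \<notin> fst ` set n_as"
      and wit: "similar_mat_wit ?A (jordan_matrix n_as) Z Z'"
      unfolding jordan_nf_def similar_mat_def by blast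
    \<comment> \<open>Blocks of size 1, in particular those at 0, demand no derivative; all larger
      ones belong to eigenvalues in the right half-plane, where \<open>powr\<close> is
      holomorphic.\<close>
    have "defined_on_block ?f m l" if "(m, l) \<in> set n_as" for m l
      unfolding defined_on_block_def
    proof (intro allI impI)
      fix k assume "Suc k < m"
      then have "0 < Re l" using blocks[OF wit that pos] by auto
      have "?f holomorphic_on {z. 0 < Re z}"
        by (intro holomorphic_intros) (auto simp: complex_nonpos_Reals_iff)
      then have "(deriv ^^ k) ?f holomorphic_on {z. 0 < Re z}"
        by (rule holomorphic_higher_deriv) (rule open_halfspace_Re_gt)
      then show "(deriv ^^ k) ?f field_differentiable at l"
        using \<open>0 < Re l\<close> open_halfspace_Re_gt[of 0] holomorphic_on_imp_differentiable_at by blast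
    qed
    then show ?thesis
      unfolding is_fun_mat_def using pos wit by blast
  qed
  then have "is_fun_mat ?f ?A (fun_mat ?f ?A)"
    unfolding fun_mat_def using unique theI by metis
  then show ?thesis
    unfolding mat_powr_def by (rule unique)
qed

text \<open>The term of index 0 is c^a times the identity, and all later terms contribute
  nonpositively.\<close>

lemma frac_generator_diag_bound:
  assumes P: "row_stochastic n (1\<^sub>m n - (1 / c) \<cdot>\<^sub>m L)" and c: "1 \<le> c" and a: "0 < a" "a \<le> 1"
    and ij: "i < n" "j < n"
  shows "frac_generator n L c a i j \<le> (if i = j then c else 0)"
proof -
  let ?p = "\<lambda>k. ((1\<^sub>m n - (1 / c) \<cdot>\<^sub>m L) ^\<^sub>m k) $$ (i, j)"
  have "dim_row L = n" using P by (auto simp: row_stochastic_def)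
  then have p0: "?p 0 = (if i = j then 1 else 0)" using ij by simp
  have "(\<Sum>k. binom_coeff_minus a k * ?p k) \<le> ?p 0"
    by (intro binomial_series_le a row_stochastic_pow_bounds[OF P] ij)
  then have "frac_generator n L c a i j \<le> c powr a * ?p 0"
    unfolding frac_generator_def by (intro mult_left_mono) auto
  \<comment> \<open>Here \<open>1 \<le> c\<close> enters; it yields a bound independent of
    \<open>a\<close>.\<close>
  moreover have "c powr a \<le> c powr 1"
    using a c by (intro powr_mono) auto
  ultimately show ?thesis using c unfolding p0 by (auto split: if_splits)
qed

text \<open>All powers have row sums 1, so what remains is the sum of the binomial coefficients,
  which is 0.\<close>

lemma frac_generator_row_sum:
  assumes P: "row_stochastic n (1\<^sub>m n - (1 / c) \<cdot>\<^sub>m L)" and a: "0 < a" "a \<le> 1" and i: "i < n"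
  shows "(\<Sum>j<n. frac_generator n L c a i j) = 0"
proof -
  let ?p = "\<lambda>j k. ((1\<^sub>m n - (1 / c) \<cdot>\<^sub>m L) ^\<^sub>m k) $$ (i, j)"
  have "(\<Sum>j<n. \<Sum>k. binom_coeff_minus a k * ?p j k) = (\<Sum>k. \<Sum>j<n. binom_coeff_minus a k * ?p j k)"
    by (intro suminf_sum[symmetric] summable_binomial_series a row_stochastic_pow_bounds(3)[OF P i]) simp
  also have "\<dots> = (\<Sum>k. binom_coeff_minus a k)"
    using row_stochastic_pow[OF P] i by (simp add: row_stochastic_def flip: sum_distrib_left)
  also have "\<dots> = 0"
    using binom_coeff_minus_sums_0[OF a] by (simp add: sums_iff)
  finally show ?thesis
    unfolding frac_generator_def sum_distrib_left[symmetric] by simp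
qed

lemma continuous_on_frac_generator:
  assumes P: "row_stochastic n (1\<^sub>m n - (1 / c) \<cdot>\<^sub>m L)" and c: "0 < c" and a0: "0 < a0"
    and ij: "i < n" "j < n"
  shows "continuous_on {a0..1} (\<lambda>a. frac_generator n L c a i j)"
  unfolding frac_generator_def
  using c by (intro continuous_intros continuous_on_binomial_series a0
      row_stochastic_pow_bounds(3)[OF P ij]) auto

section \<open>The Peano-Baker series of a nonnegative system\<close>

section \<open>Linear differential equations with nonnegative coefficients\<close>

text \<open>The differences of successive Picard iterates for \<open>u' = u K\<close>,
  \<open>u(0) = q\<close>, that is, the terms of the Peano-Baker series.\<close>

primrec picard_term ::
  "nat \<Rightarrow> (real \<Rightarrow> nat \<Rightarrow> nat \<Rightarrow> real) \<Rightarrow> (nat \<Rightarrow> real) \<Rightarrow> nat \<Rightarrow> real \<Rightarrow> nat \<Rightarrow> real" where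
  "picard_term n K q 0 = (\<lambda>t j. q j)"
| "picard_term n K q (Suc k) =
     (\<lambda>t j. integral {0..t} (\<lambda>s. \<Sum>i<n. picard_term n K q k s i * K s i j))"

text \<open>Since \<open>K\<close> has row sums \<open>c\<close>, the total mass of each term is
  \<open>c\<close> times the integral of the preceding mass. The claims are proved together because
  the integrals need continuity of the preceding term.\<close>

lemma picard_term_properties:
  assumes K: "\<And>i j. i < n \<Longrightarrow> j < n \<Longrightarrow> continuous_on {0..T} (\<lambda>t. K t i j)"
    and K_nonneg: "\<And>t i j. t \<in> {0..T} \<Longrightarrow> i < n \<Longrightarrow> j < n \<Longrightarrow> 0 \<le> K t i j"
    and K_sum: "\<And>t i. t \<in> {0..T} \<Longrightarrow> i < n \<Longrightarrow> (\<Sum>j<n. K t i j) = c"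
    and q: "\<And>j. j < n \<Longrightarrow> 0 \<le> q j" "(\<Sum>j<n. q j) = 1"
  shows "(\<forall>j<n. continuous_on {0..T} (\<lambda>t. picard_term n K q k t j)) \<and>
    (\<forall>t\<in>{0..T}. \<forall>j<n. 0 \<le> picard_term n K q k t j) \<and>
    (\<forall>t\<in>{0..T}. (\<Sum>j<n. picard_term n K q k t j) = (c * t) ^ k / fact k)"
proof (induction k)
  case 0
  show ?case using q by simp
next
  case (Suc k)
  let ?v = "picard_term n K q k"
  let ?g = "\<lambda>j s. \<Sum>i<n. ?v s i * K s i j"
  have cont: "continuous_on {0..T} (?g j)" if "j < n" for j
    using Suc K that by (intro continuous_intros) auto
  have int: "?g j integrable_on {0..t}" if "j < n" "t \<in> {0..T}" for j t
    using cont[OF that(1)] that(2)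
    by (intro integrable_continuous_interval) (auto elim: continuous_on_subset)
  have "continuous_on {0..T} (\<lambda>t. integral {0..t} (?g j))" if "j < n" for j
    by (intro indefinite_integral_continuous_1 integrable_continuous_interval cont that)
  moreover have "0 \<le> integral {0..t} (?g j)" if "j < n" "t \<in> {0..T}" for j t
    using that Suc K_nonneg by (intro integral_nonneg int sum_nonneg mult_nonneg_nonneg) auto
  moreover have "(\<Sum>j<n. integral {0..t} (?g j)) = (c * t) ^ Suc k / fact (Suc k)"
    if t: "t \<in> {0..T}" for t
  proof -
    have "(\<Sum>j<n. integral {0..t} (?g j)) = integral {0..t} (\<lambda>s. \<Sum>j<n. ?g j s)"
      using int t by (subst integral_sum) auto
    also have "\<dots> = integral {0..t} (\<lambda>s. c * ((c * s) ^ k / fact k))"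
    proof (rule integral_cong)
      fix s assume "s \<in> {0..t}"
      then have s: "s \<in> {0..T}" using t by auto
      have "(\<Sum>j<n. ?g j s) = (\<Sum>i<n. ?v s i * (\<Sum>j<n. K s i j))"
        by (subst sum.swap) (simp add: sum_distrib_left)
      also have "\<dots> = (\<Sum>i<n. ?v s i) * c"
        using K_sum[OF s] by (simp add: sum_distrib_right)
      also have "\<dots> = c * ((c * s) ^ k / fact k)"
        using Suc s by simp
      finally show "(\<Sum>j<n. ?g j s) = c * ((c * s) ^ k / fact k)" .
    qed
    also have "((\<lambda>s. c * ((c * s) ^ k / fact k)) has_integral
        (c * t) ^ Suc k / fact (Suc k) - (c * 0) ^ Suc k / fact (Suc k)) {0..t}"
    proof (rule fundamental_theorem_of_calculus)
      fix s
      have "((\<lambda>s. c * s) has_real_derivative c) (at s within {0..t})"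
        by (auto intro!: derivative_eq_intros)
      then have "((\<lambda>s. (c * s) ^ Suc k / fact (Suc k)) has_real_derivative
          ((1 + of_nat k) * (c * (c * s) ^ k)) / fact (Suc k)) (at s within {0..t})"
        by (intro DERIV_cdivide DERIV_power_Suc)
      also have "((1 + of_nat k) * (c * (c * s) ^ k)) / fact (Suc k) = c * ((c * s) ^ k / fact k)"
        by (simp add: divide_simps)
      finally show "((\<lambda>s. (c * s) ^ Suc k / fact (Suc k)) has_vector_derivative
          c * ((c * s) ^ k / fact k)) (at s within {0..t})"
        by (simp only: has_real_derivative_iff_has_vector_derivative)
    qed (use t in auto)
    then have "integral {0..t} (\<lambda>s. c * ((c * s) ^ k / fact k)) = (c * t) ^ Suc k / fact (Suc k)"
      by (subst integral_unique) auto
    finally show ?thesis .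
  qed
  ultimately show ?case by simp
qed

lemma uniform_limit_sum:
  fixes f :: "nat \<Rightarrow> 'b \<Rightarrow> 'a \<Rightarrow> 'c :: real_normed_vector"
  assumes "\<And>i. i < n \<Longrightarrow> uniform_limit S (f i) (l i) F"
  shows "uniform_limit S (\<lambda>N t. \<Sum>i<n. f i N t) (\<lambda>t. \<Sum>i<n. l i t) F"
  using assms by (induction n) (simp_all add: uniform_limit_const uniform_limit_add)

text \<open>A nonnegative term is bounded by its total mass, so the Picard terms are dominated by
  the series of exp (c T). This permits summation and termwise differentiation, and the masses add
  up to the exponential.\<close>

lemma nonneg_linear_ode:
  fixes n :: nat and K :: "real \<Rightarrow> nat \<Rightarrow> nat \<Rightarrow> real" and q :: "nat \<Rightarrow> real"
  assumes T: "0 \<le> T"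
    and K: "\<And>i j. i < n \<Longrightarrow> j < n \<Longrightarrow> continuous_on {0..T} (\<lambda>t. K t i j)"
    and K_nonneg: "\<And>t i j. t \<in> {0..T} \<Longrightarrow> i < n \<Longrightarrow> j < n \<Longrightarrow> 0 \<le> K t i j"
    and K_sum: "\<And>t i. t \<in> {0..T} \<Longrightarrow> i < n \<Longrightarrow> (\<Sum>j<n. K t i j) = c"
    and q: "\<And>j. j < n \<Longrightarrow> 0 \<le> q j" "(\<Sum>j<n. q j) = 1"
  obtains u where "\<And>j. j < n \<Longrightarrow> u 0 j = q j"
    and "\<And>t j. t \<in> {0..T} \<Longrightarrow> j < n \<Longrightarrow> 0 \<le> u t j"
    and "\<And>t. t \<in> {0..T} \<Longrightarrow> (\<Sum>j<n. u t j) = exp (c * t)"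
    and "\<And>t j. t \<in> {0..T} \<Longrightarrow> j < n \<Longrightarrow>
      ((\<lambda>s. u s j) has_real_derivative (\<Sum>i<n. u t i * K t i j)) (at t within {0..T})"
proof
  define v where "v = picard_term n K q"
  define u where "u t j = (\<Sum>k. v k t j)" for t j
  note props = picard_term_properties[of n T K c q, OF K K_nonneg K_sum q, folded v_def]
  have v_cont: "continuous_on {0..T} (\<lambda>t. v k t j)" if "j < n" for k j
    using props that by blast
  have v_nonneg: "0 \<le> v k t j" if "t \<in> {0..T}" "j < n" for k t j
    using props that by blast
  have v_sum: "(\<Sum>j<n. v k t j) = (c * t) ^ k / fact k" if "t \<in> {0..T}" for k t
    using props that by blast
  have v_0: "v 0 t j = q j" for t j by (simp add: v_def)
  \<comment> \<open>\<open>c\<close> is a sum of nonnegative entries; a row exists because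
    \<open>q\<close> has sum 1.\<close>
  have c: "0 \<le> c"
  proof -
    have "0 < n" using q by (cases n) auto
    then show ?thesis using K_nonneg[of 0] K_sum[of 0 0] T by (force intro: sum_nonneg)
  qed
  have v_le: "v k t j \<le> (c * T) ^ k / fact k" if t: "t \<in> {0..T}" and j: "j < n" for k t j
  proof -
    have "v k t j \<le> (\<Sum>j<n. v k t j)"
      using v_nonneg[OF t] j by (intro member_le_sum) auto
    also have "\<dots> \<le> (c * T) ^ k / fact k"
      unfolding v_sum[OF t] using c t
      by (intro divide_right_mono power_mono mult_left_mono) auto
    finally show ?thesis .
  qed
  have exp_sum: "summable (\<lambda>k. (c * T) ^ k / fact k)"
    using summable_exp[of "c * T"] by (simp add: field_simps)
  have v_summable: "summable (\<lambda>k. v k t j)" if "t \<in> {0..T}" "j < n" for t j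
    by (rule summable_comparison_test'[OF exp_sum]) (use v_nonneg v_le that in simp)
  have ul: "uniform_limit {0..T} (\<lambda>N t. \<Sum>k<N. v k t j) (\<lambda>t. u t j) sequentially"
    if "j < n" for j
    unfolding u_def by (rule Weierstrass_m_test[OF _ exp_sum]) (use v_nonneg v_le that in simp)
  have u_cont: "continuous_on {0..T} (\<lambda>t. u t j)" if "j < n" for j
    by (rule uniform_limit_theorem[OF _ ul[OF that]])
      (auto intro!: always_eventually continuous_intros v_cont that)
  \<comment> \<open>The derivative of the \<open>k\<close>-th term: the constant initial term
    contributes 0, every other one its predecessor times \<open>K\<close>.\<close>
  define v' where "v' k t j = (case k of 0 \<Rightarrow> 0 | Suc k \<Rightarrow> (\<Sum>i<n. v k t i * K t i j))" for k t j
  have deriv_v: "((\<lambda>t. v k t j) has_real_derivative v' k t j) (at t within {0..T})"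
    if "t \<in> {0..T}" "j < n" for k t j
  proof (cases k)
    case (Suc l)
    show ?thesis
      unfolding Suc v'_def v_def picard_term.simps nat.case using that K props
      by (intro integral_has_real_derivative continuous_intros) (auto simp: v_def)
  qed (simp add: v_def v'_def)
  have deriv_ul: "uniform_limit {0..T} (\<lambda>N t. \<Sum>k<N. v' k t j)
      (\<lambda>t. \<Sum>i<n. u t i * K t i j) sequentially" if "j < n" for j
  proof -
    \<comment> \<open>Uniform limits can be multiplied only when the limits are bounded.\<close>
    have bK: "bounded ((\<lambda>t. K t i j) ` {0..T})" if "i < n" for i
      using K[OF that \<open>j < n\<close>] by (intro compact_imp_bounded compact_continuous_image) auto
    have bu: "bounded ((\<lambda>t. u t i) ` {0..T})" if "i < n" for i
      using u_cont[OF that] by (intro compact_imp_bounded compact_continuous_image) auto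
    have "uniform_limit {0..T} (\<lambda>N t. \<Sum>i<n. (\<Sum>k<N. v k t i) * K t i j)
        (\<lambda>t. \<Sum>i<n. u t i * K t i j) sequentially"
      by (intro uniform_limit_sum uniform_lim_mult ul bK bu uniform_limit_const) auto
    \<comment> \<open>\<open>Suc N\<close> derivatives correspond to \<open>N\<close> terms of
      \<open>u\<close>, as the derivative of the initial term vanishes.\<close>
    then have "uniform_limit {0..T} (\<lambda>N t. \<Sum>k<Suc N. v' k t j)
        (\<lambda>t. \<Sum>i<n. u t i * K t i j) sequentially"
    proof (rule uniform_limit_cong[THEN iffD1, rotated -1])
      show "\<forall>\<^sub>F N in sequentially. \<forall>t\<in>{0..T}.
          (\<Sum>i<n. (\<Sum>k<N. v k t i) * K t i j) = (\<Sum>k<Suc N. v' k t j)"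
        by (subst sum.lessThan_Suc_shift)
          (auto simp: v'_def sum_distrib_right intro!: always_eventually sum.swap)
    qed simp
    then show ?thesis
      using filterlim_sequentially_Suc[of "\<lambda>N t. \<Sum>k<N. v' k t j"] by blast
  qed
  show "u 0 j = q j" if "j < n" for j
  proof -
    have "v (Suc k) 0 j = 0" for k by (simp add: v_def)
    then show ?thesis
      unfolding u_def using suminf_split_head[OF v_summable[of 0 j]] that T v_0 by simp
  qed
  show "0 \<le> u t j" if "t \<in> {0..T}" "j < n" for t j
    unfolding u_def by (intro suminf_nonneg v_summable v_nonneg that)
  show "(\<Sum>j<n. u t j) = exp (c * t)" if "t \<in> {0..T}" for t
  proof -
    have "(\<Sum>j<n. u t j) = (\<Sum>k. \<Sum>j<n. v k t j)"
      unfolding u_def using v_summable[OF that] by (subst suminf_sum) auto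
    also have "\<dots> = exp (c * t)"
      unfolding exp_def using v_sum[OF that] by (simp add: divide_inverse mult.commute)
    finally show ?thesis .
  qed
  show "((\<lambda>s. u s j) has_real_derivative (\<Sum>i<n. u t i * K t i j)) (at t within {0..T})"
    if t: "t \<in> {0..T}" and j: "j < n" for t j
  proof -
    \<comment> \<open>Termwise differentiation provides some sum function \<open>g\<close>;
      uniqueness of sums identifies it with \<open>u\<close> on the interval.\<close>
    obtain g where g: "\<forall>t\<in>{0..T}. (\<lambda>k. v k t j) sums g t \<and>
        (g has_real_derivative (\<Sum>i<n. u t i * K t i j)) (at t within {0..T})"
      using has_field_derivative_series[OF convex_real_interval(5) deriv_v[OF _ j] deriv_ul[OF j] t
          v_summable[OF t j]] by blast
    then have "g s = u s j" if "s \<in> {0..T}" for s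
      using that sums_unique unfolding u_def by blast
    then show ?thesis
      using g t has_field_derivative_transform_within[of g _ t "{0..T}" 1 "\<lambda>s. u s j"] by auto
  qed
qed

section \<open>From the Laplacian to the variable-order problem\<close>

section \<open>The Laplacian\<close>

lemma laplacian_mat_carrier: "laplacian_mat n v G \<in> carrier_mat n n"
  by (rule carrier_matI) (simp_all add: laplacian_mat_def Let_def adjacency_mat_def mat_diag_def)

lemma laplacian_mat_index:
  assumes "i < n" "j < n"
  shows "laplacian_mat n v G $$ (i, j) =
    (if i = j then \<Sum>k<n. adjacency_mat n v G $$ (i, k) else 0) - adjacency_mat n v G $$ (i, j)"
  using assms
  by (simp add: laplacian_mat_def Let_def mat_diag_def adjacency_mat_def scalar_prod_def atLeast0LessThan)

text \<open>Every out-degree, self-loops included, is at most \<open>n\<close>, which keeps the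
  diagonal nonnegative; \<open>n + 1\<close> is positive also for \<open>n = 0\<close>. The row sums
  are 1 because those of the Laplacian vanish.\<close>

lemma laplacian_mat_row_stochastic:
  "row_stochastic n (1\<^sub>m n - (1 / (real n + 1)) \<cdot>\<^sub>m laplacian_mat n v G)"
proof -
  let ?b = "real n + 1" and ?A = "\<lambda>i j. adjacency_mat n v G $$ (i, j)"
  let ?S = "1\<^sub>m n - (1 / ?b) \<cdot>\<^sub>m laplacian_mat n v G"
  have b: "0 < ?b" by simp
  have A: "0 \<le> ?A i j" "?A i j \<le> 1" if "i < n" "j < n" for i j
    using that by (simp_all add: adjacency_mat_def)
  have deg: "(\<Sum>k<n. ?A i k) \<le> ?b" if "i < n" for i
    using sum_bounded_above[of "{..<n}" "?A i" 1] A that by simp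
  have S: "?S $$ (i, j) = (if i = j then 1 - (\<Sum>k<n. ?A i k) / ?b else 0) + ?A i j / ?b"
    if "i < n" "j < n" for i j
    using that laplacian_mat_carrier[of n v G] by (simp add: laplacian_mat_index diff_divide_distrib)
  have "0 \<le> ?S $$ (i, j)" if "i < n" "j < n" for i j
  proof -
    have "0 \<le> 1 - (\<Sum>k<n. ?A i k) / ?b" using deg[OF that(1)] b by simp
    then have "0 \<le> (if i = j then 1 - (\<Sum>k<n. ?A i k) / ?b else 0)" by (cases "i = j") simp_all
    moreover have "0 \<le> ?A i j / ?b" using A(1)[OF that] b by simp
    ultimately show ?thesis unfolding S[OF that] by (rule add_nonneg_nonneg)
  qed
  moreover have "(\<Sum>j<n. ?S $$ (i, j)) = 1" if "i < n" for i
  proof -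
    have "(\<Sum>j<n. ?S $$ (i, j)) =
        (\<Sum>j<n. (if i = j then 1 - (\<Sum>k<n. ?A i k) / ?b else 0) + ?A i j / ?b)"
      using S that by (intro sum.cong) auto
    then show ?thesis
      using that by (simp add: sum.distrib flip: sum_divide_distrib)
  qed
  moreover have "?S \<in> carrier_mat n n"
    by (intro minus_carrier_mat smult_carrier_mat laplacian_mat_carrier)
  ultimately show ?thesis by (intro row_stochasticI)
qed

theorem theorem3p4:
  fixes G :: "'a pair_pre_digraph" and v :: "nat \<Rightarrow> 'a" and n :: nat
    and \<alpha> :: "real \<Rightarrow> real" and p0 :: "real vec"
  assumes "pair_fin_digraph G"
    and "bij_betw v {..<n} (pverts G)"
    and "continuous_on {0..} \<alpha>"
    and "\<forall>t \<ge> 0. 0 < \<alpha> t \<and> \<alpha> t \<le> 1"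
    and "p0 \<in> carrier_vec n"
    and "\<forall>j < n. 0 \<le> p0 $ j"
    and "(\<Sum>j < n. p0 $ j) = 1"
  shows "\<forall>T > 0. \<exists>p. solves_ivp n (\<lambda>t. mat_powr (laplacian_mat n v G) (\<alpha> t)) p0 T p \<and>
           (\<forall>t \<in> {0..T}. norm1_vec (p t) = 1)"
proof (intro allI impI)
  fix T :: real
  assume T: "0 < T"
  define L where "L = laplacian_mat n v G"
  define b where "b = real n + 1"
  define c where "c = 2 * b"
  define M where "M t i j = frac_generator n L c (\<alpha> t) i j" for t i j
  define K where "K t i j = (if i = j then c else 0) - M t i j" for t i j
  have L: "L \<in> carrier_mat n n" unfolding L_def by (rule laplacian_mat_carrier)
  have S: "row_stochastic n (1\<^sub>m n - (1 / b) \<cdot>\<^sub>m L)"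
    unfolding L_def b_def by (rule laplacian_mat_row_stochastic)
  have P: "row_stochastic n (1\<^sub>m n - (1 / c) \<cdot>\<^sub>m L)"
    unfolding c_def by (rule row_stochastic_half[OF L S])
  have c: "1 \<le> c" "0 < c" by (simp_all add: c_def b_def)
  have \<alpha>: "0 < \<alpha> t" "\<alpha> t \<le> 1" if "t \<in> {0..T}" for t
    using assms(4) that by auto
  have powr: "mat_powr L (\<alpha> t) = mat n n (\<lambda>(i, j). of_real (M t i j))" if "t \<in> {0..T}" for t
    unfolding M_def c_def using \<alpha>[OF that] by (intro mat_powr_eq[OF L _ S]) (simp_all add: b_def)
  have \<alpha>_cont: "continuous_on {0..T} \<alpha>"
    using assms(3) by (rule continuous_on_subset) auto
  \<comment> \<open>On the compact interval the order has a positive minimum, so it stays in a range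
    on which the entries of L^a are continuous in \<open>a\<close>.\<close>
  obtain t0 where t0: "t0 \<in> {0..T}" "\<And>t. t \<in> {0..T} \<Longrightarrow> \<alpha> t0 \<le> \<alpha> t"
    using continuous_attains_inf[of "{0..T}" \<alpha>] \<alpha>_cont T by auto
  have M_cont: "continuous_on {0..T} (\<lambda>t. M t i j)" if "i < n" "j < n" for i j
    unfolding M_def
    by (rule continuous_on_compose2[OF continuous_on_frac_generator[OF P c(2) \<alpha>(1)[OF t0(1)] that] \<alpha>_cont])
      (use t0 \<alpha> in auto)
  have K_cont: "continuous_on {0..T} (\<lambda>t. K t i j)" if "i < n" "j < n" for i j
    unfolding K_def by (intro continuous_intros M_cont that)
  have K_nonneg: "0 \<le> K t i j" if "t \<in> {0..T}" "i < n" "j < n" for t i j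
    using frac_generator_diag_bound[OF P c(1) \<alpha>[OF that(1)] that(2,3)] by (simp add: K_def M_def)
  have K_sum: "(\<Sum>j<n. K t i j) = c" if "t \<in> {0..T}" "i < n" for t i
    using frac_generator_row_sum[OF P \<alpha>[OF that(1)] that(2)] that(2) by (simp add: K_def M_def sum_subtractf)
  obtain u where u0: "\<And>j. j < n \<Longrightarrow> u 0 j = p0 $ j"
    and u_nonneg: "\<And>t j. t \<in> {0..T} \<Longrightarrow> j < n \<Longrightarrow> 0 \<le> u t j"
    and u_sum: "\<And>t. t \<in> {0..T} \<Longrightarrow> (\<Sum>j<n. u t j) = exp (c * t)"
    and u_deriv: "\<And>t j. t \<in> {0..T} \<Longrightarrow> j < n \<Longrightarrow>
      ((\<lambda>s. u s j) has_real_derivative (\<Sum>i<n. u t i * K t i j)) (at t within {0..T})"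
    using nonneg_linear_ode[of T n K c "\<lambda>j. p0 $ j", OF order_less_imp_le[OF T] K_cont K_nonneg K_sum]
      assms(6,7) by blast
  \<comment> \<open>The factor exp (- c t) cancels the summand \<open>c 1\<close> of
    \<open>K\<close>, leaving \<open>- M\<close>, and normalises the total mass exp (c t) of
    \<open>u\<close> to 1.\<close>
  define p where "p t = vec n (\<lambda>j. exp (- (c * t)) * u t j)" for t
  have deriv: "((\<lambda>s. p s $ j) has_real_derivative - (\<Sum>i<n. p t $ i * M t i j)) (at t within {0..T})"
    if t: "t \<in> {0..T}" and j: "j < n" for t j
  proof -
    have "((\<lambda>s. exp (- (c * s)) * u s j) has_real_derivative
        exp (- (c * t)) * (\<Sum>i<n. u t i * K t i j) - c * exp (- (c * t)) * u t j) (at t within {0..T})"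
      by (auto intro!: derivative_eq_intros u_deriv[OF t j])
    also have "(\<Sum>i<n. u t i * K t i j) = c * u t j - (\<Sum>i<n. u t i * M t i j)"
      using j by (simp add: K_def right_diff_distrib sum_subtractf if_distrib[of "(*) _"] cong: if_cong)
    finally show ?thesis
      using j by (simp add: p_def right_diff_distrib sum_distrib_left mult.assoc mult.left_commute)
  qed
  have "norm1_vec (p t) = 1" if "t \<in> {0..T}" for t
  proof -
    have "norm1_vec (p t) = exp (- (c * t)) * (\<Sum>j<n. u t j)"
      using u_nonneg[OF that] by (simp add: norm1_vec_def p_def sum_distrib_left)
    then show ?thesis by (simp add: u_sum[OF that] exp_minus)
  qed
  moreover have "solves_ivp n (\<lambda>t. mat_powr L (\<alpha> t)) p0 T p"
    unfolding solves_ivp_def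
  proof (intro conjI ballI allI impI)
    show "p t \<in> carrier_vec n" for t by (simp add: p_def)
    show "continuous_on {0..T} (\<lambda>t. p t $ j)" if "j < n" for j
      using deriv[OF _ that] by (rule DERIV_continuous_on)
    show "p 0 = p0"
      by (rule eq_vecI) (use assms(5) u0 in \<open>auto simp: p_def\<close>)
    fix t j assume t: "t \<in> {0<..T}" and j: "j < n"
    have "((\<lambda>s. complex_of_real (p s $ j)) has_vector_derivative
        of_real (- (\<Sum>i<n. p t $ i * M t i j))) (at t within {0..T})"
      using deriv[of t j] t j
      by (intro has_vector_derivative_of_real) (simp add: has_real_derivative_iff_has_vector_derivative)
    also have "of_real (- (\<Sum>i<n. p t $ i * M t i j)) =
        (- row_mult_mat (map_vec complex_of_real (p t)) (mat_powr L (\<alpha> t))) $ j"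
      using t j by (simp add: powr row_mult_mat_def scalar_prod_def p_def atLeast0LessThan)
    finally show "((\<lambda>s. complex_of_real (p s $ j)) has_vector_derivative
        (- row_mult_mat (map_vec complex_of_real (p t)) (mat_powr L (\<alpha> t))) $ j) (at t within {0..T})" .
  qed
  ultimately show "\<exists>p. solves_ivp n (\<lambda>t. mat_powr (laplacian_mat n v G) (\<alpha> t)) p0 T p \<and>
      (\<forall>t \<in> {0..T}. norm1_vec (p t) = 1)"
    unfolding L_def by blast
qed

end
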